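(* There exist an absolute constant $c>0$ and a positive integer $n_0$ such that for all integers $n\ge n_0$ $$ d'_n(\mathbb{R},\infty)\ge c\,\sqrt{\frac{\ln n}{n}}, $$ where $$ d'_n(\mathbb{R},\infty)=\inf\left\{Y(\rho_n):\ \|\rho_n'\|_{L^\infty(\mathbb{R})}\le 1\right\}, $$ the infimum being taken over all simple partial fractions $\rho_n$ of order $n$ satisfying $\|\rho_n'\|_{L^\infty(\mathbb{R})}\le 1$.
   Context: A simple partial fraction of order $n$ is the logarithmic derivative of an algebraic polynomial $Q(z)=\prod_{k=1}^m (z-\xi_k)^{n_k}$ of degree $n=\sum_{k=1}^m n_k$ with distinct complex roots $\xi_k$ and multiplicities $n_k\in\mathbb{N}$, i.e. $\rho_n(z)=\sum_{k=1}^m \frac{n_k}{z-\xi_k}$. For such $\rho_n$, $Y(\rho_n):=\min_{k=1,\dots,m}|\mathrm{Im}\,\xi_k|$, and $\rho_n'$ denotes the derivative of $\rho_n$. The poles may lie in both the upper and the lower half-plane. *)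

theory Defs
  imports "HOL-Probability.Essential_Supremum" "HOL-Computational_Algebra.Polynomial"
begin

text \<open>A simple partial fraction is given by the finite set \<open>S\<close> of its (distinct, complex) poles
  and the multiplicity function \<open>\<nu>\<close>; values of \<open>\<nu>\<close> outside \<open>S\<close> are irrelevant.\<close>

definition pole_data :: "nat \<Rightarrow> complex set \<Rightarrow> (complex \<Rightarrow> nat) \<Rightarrow> bool" where
  "pole_data n S \<nu> \<longleftrightarrow> finite S \<and> (\<forall>\<xi>\<in>S. \<nu> \<xi> \<ge> 1) \<and> (\<Sum>\<xi>\<in>S. \<nu> \<xi>) = n"

definition pole_poly :: "complex set \<Rightarrow> (complex \<Rightarrow> nat) \<Rightarrow> complex poly" where
  "pole_poly S \<nu> = (\<Prod>\<xi>\<in>S. [:-\<xi>, 1:] ^ \<nu> \<xi>)"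

definition spf :: "complex set \<Rightarrow> (complex \<Rightarrow> nat) \<Rightarrow> complex \<Rightarrow> complex" where
  "spf S \<nu> z = (\<Sum>\<xi>\<in>S. of_nat (\<nu> \<xi>) / (z - \<xi>))"

lemma degree_pole_poly:
  assumes "pole_data n S \<nu>"
  shows "degree (pole_poly S \<nu>) = n"
  using assms unfolding pole_data_def pole_poly_def
  by (subst degree_prod_eq_sum_degree) (auto simp: degree_power_eq)

lemma spf_eq_log_derivative:
  assumes "finite S" "z \<notin> S"
  shows "spf S \<nu> z = deriv (poly (pole_poly S \<nu>)) z / poly (pole_poly S \<nu>) z"
proof -
  have "poly (pderiv (pole_poly S \<nu>)) z = spf S \<nu> z * poly (pole_poly S \<nu>) z
        \<and> poly (pole_poly S \<nu>) z \<noteq> 0"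
    using assms
  proof (induction S)
    case empty
    show ?case by (simp add: pole_poly_def spf_def)
  next
    case (insert \<xi> T)
    have ne: "z - \<xi> \<noteq> 0" using insert.prems by auto
    have IH: "poly (pderiv (pole_poly T \<nu>)) z = spf T \<nu> z * poly (pole_poly T \<nu>) z"
      "poly (pole_poly T \<nu>) z \<noteq> 0" using insert by auto
    have split: "pole_poly (insert \<xi> T) \<nu> = [:-\<xi>, 1:] ^ \<nu> \<xi> * pole_poly T \<nu>"
      "spf (insert \<xi> T) \<nu> z = of_nat (\<nu> \<xi>) / (z - \<xi>) + spf T \<nu> z"
      using insert.hyps by (simp_all add: pole_poly_def spf_def)
    have pw: "poly (pderiv ([:-\<xi>, 1:] ^ \<nu> \<xi>)) z = of_nat (\<nu> \<xi>) / (z - \<xi>) * (z - \<xi>) ^ \<nu> \<xi>"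
      using ne by (cases "\<nu> \<xi>") (simp_all add: pderiv_power_Suc pderiv_pCons field_simps del: power_Suc, simp_all add: algebra_simps)
    show ?case unfolding split pderiv_mult using IH ne pw
      by (simp add: algebra_simps)
  qed
  moreover have "deriv (poly (pole_poly S \<nu>)) z = poly (pderiv (pole_poly S \<nu>)) z"
    by (rule DERIV_imp_deriv) (rule poly_DERIV)
  ultimately show ?thesis by simp
qed

definition Y :: "complex set \<Rightarrow> real" where
  "Y S = Min ((\<lambda>\<xi>. \<bar>Im \<xi>\<bar>) ` S)"

text \<open>The \<open>L\<^sup>\<infinity>\<close> norm over the real line of a function of a complex variable. It may be infinite,
  and values on a null set (such as those of \<open>deriv (spf S \<nu>)\<close> at real poles) do not matter.\<close>

definition Linf_norm_real_line :: "(complex \<Rightarrow> complex) \<Rightarrow> ereal" where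
  "Linf_norm_real_line f = esssup lborel (\<lambda>x::real. ereal (norm (f (of_real x))))"

text \<open>The infimum is taken in the extended reals, so that no junk value arises for an empty set.\<close>

definition d' :: "nat \<Rightarrow> ereal" where
  "d' n = Inf {ereal (Y S) | S \<nu>. pole_data n S \<nu> \<and> Linf_norm_real_line (deriv (spf S \<nu>)) \<le> 1}"

end

theory Submission
  imports Defs "HOL-Complex_Analysis.Conformal_Mappings"
begin

text \<open>Reflecting poles across the real line preserves the real part of the derivative there, so all
  poles \<open>\<zeta>\<close> may be assumed to satisfy \<open>Im \<zeta> \<le> -y\<close>, with one of them, \<open>\<zeta>\<^sub>0\<close>, on the line
  \<open>Im z = -y\<close>. Write \<open>\<rho>\<close> for the resulting simple partial fraction and \<open>U = -Im \<rho> > 0\<close>. By the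
  maximum principle \<open>|Re \<rho>'| \<le> 1\<close> in the upper half-plane. Hence \<open>U\<close> is \<open>1\<close>-Lipschitz
  on vertical lines, and comparison with its value at height \<open>\<surd>n\<close>, which is at most \<open>\<surd>n\<close>, gives
  \<open>U \<le> 2\<surd>n\<close>. Put \<open>z = Re \<zeta>\<^sub>0 + 2iy\<close> and \<open>s(\<zeta>) = 3iy / (z - \<zeta>)\<close>; then \<open>|s|\<^sup>2 \<le> Re s\<close> and
  \<open>s(\<zeta>\<^sub>0) = 1\<close>. Sum the kernel \<open>s / (1 + \<epsilon> - s)\<close>, whose real part is nonnegative, over all poles:
  the pole \<open>\<zeta>\<^sub>0\<close> alone contributes \<open>1/\<epsilon>\<close>, while in the expansion in powers of \<open>s\<close> the linear term
  gives \<open>3 y U(z) \<le> 6 y \<surd>n\<close> and the term of degree \<open>j \<ge> 2\<close> is a multiple of a Taylor coefficient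
  of \<open>\<rho>'\<close> at \<open>z\<close>, so that its real part is at most \<open>4 y\<^sup>2 3\<^sup>j\<close> by Cauchy's inequality. Truncating at degree
  \<open>m \<approx> (ln n)/4\<close> with \<open>\<epsilon> = 1/\<surd>m\<close> keeps the remainder below the linear term and yields
  \<open>\<surd>m \<le> 12 y \<surd>n + 6 \<cdot> 3\<^sup>m y\<^sup>2\<close>.\<close>

section \<open>The kernel \<open>s / (1 + e - s)\<close> on the disc with diameter [0, 1]\<close>

text \<open>The real part has the sign of \<open>(1 + e) * Re s - (cmod s)\<^sup>2\<close>, which is
  at least \<open>e * Re s\<close> on this disc. Nonnegativity is what later allows a single pole to
  be bounded by the sum over all poles.\<close>

lemma Re_Cauchy_kernel_nonneg:
  fixes s :: complex
  assumes s: "(cmod s)\<^sup>2 \<le> Re s" and e: "0 < e"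
  shows "0 \<le> Re (s / (1 + of_real e - s))"
proof -
  have "Re s \<ge> 0" using s by (meson order_trans zero_le_power2)
  then have "0 \<le> (1 + e) * Re s - (cmod s)\<^sup>2"
    using s e mult_nonneg_nonneg[of e "Re s"] unfolding distrib_right by linarith
  also have "\<dots> = Re s * (1 + e - Re s) + Im s * (- Im s)"
    by (simp only: cmod_power2) (simp add: power2_eq_square algebra_simps)
  finally show ?thesis
    by (simp add: Re_divide)
qed

text \<open>Expanding geometrically in \<open>s / (1 + e)\<close> leaves the remainder
  \<open>(s / (1 + e)) ^ m\<close> times the kernel, whose modulus is at most \<open>1 / e\<close>
  because \<open>cmod s \<le> 1\<close>. By \<open>em\<close> the remainder is at most
  \<open>cmod s ^ m \<le> (cmod s)\<^sup>2 \<le> Re s\<close>; this is the additional linear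
  term.\<close>

lemma Re_Cauchy_kernel_le:
  fixes s :: complex
  assumes s: "(cmod s)\<^sup>2 \<le> Re s" and e: "0 < e" and m: "2 \<le> m" and em: "1 \<le> e * (1 + e) ^ m"
  shows "Re (s / (1 + of_real e - s)) \<le> Re s + (\<Sum>j=1..m. Re (s ^ j) / (1 + e) ^ j)"
proof -
  have "cmod s * cmod s \<le> cmod s * 1"
    using s complex_Re_le_cmod[of s] by (simp add: power2_eq_square)
  then have s1: "cmod s \<le> 1"
    by (metis mult_le_cancel_left norm_not_less_zero order_less_le zero_le_one norm_ge_zero)
  define w where "w = s / of_real (1 + e)"
  define p where "p = s / (1 + of_real e - s)"
  have ne: "1 + of_real e - s \<noteq> 0"
  proof
    assume "1 + of_real e - s = 0"
    then have "s = of_real (1 + e)" by simp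
    then have "cmod s = \<bar>1 + e\<bar>" by (simp only: norm_of_real)
    then show False using s1 e by simp
  qed
  have ne': "of_real (1 + e) \<noteq> (0::complex)"
    using e by (metis add_pos_pos less_numeral_extra(3) of_real_eq_0_iff zero_less_one)
  have "p * (1 + of_real e - s) = s" using ne by (simp add: p_def)
  then have "p * of_real (1 + e) = s + s * p" by (simp add: algebra_simps)
  then have "p = (s + s * p) / of_real (1 + e)"
    using ne' by (simp only: nonzero_eq_divide_eq[OF ne'])
  then have wp: "p = w + w * p"
    unfolding w_def by (simp add: add_divide_distrib)
  have expand: "p = (\<Sum>j=1..k. w ^ j) + w ^ k * p" for k
  proof (induction k)
    case (Suc k)
    have "w ^ k * p = w ^ Suc k + w ^ Suc k * p"
      by (subst wp) (simp add: algebra_simps)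
    then show ?case using Suc by (simp add: add.assoc)
  qed simp
  have Re_w: "Re (w ^ j) = Re (s ^ j) / (1 + e) ^ j" for j
    unfolding w_def power_divide by (metis Re_divide_of_real of_real_power)
  have "e \<le> cmod (of_real (1 + e)) - cmod s"
    using s1 e by (simp only: norm_of_real)
  also have "\<dots> \<le> cmod (1 + of_real e - s)"
    using norm_triangle_ineq2[of "of_real (1 + e)" s] by simp
  finally have "e * cmod s \<le> cmod (1 + of_real e - s)"
    using mult_left_le[OF s1, of e] e by linarith
  then have p_le: "cmod p \<le> 1 / e"
    using ne e by (simp add: p_def norm_divide divide_simps mult.commute)
  have cmod_w: "cmod w = cmod s / (1 + e)"
    unfolding w_def norm_divide norm_of_real using e by simp
  have "Re (w ^ m * p) \<le> cmod (w ^ m * p)" by (rule complex_Re_le_cmod)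
  also have "\<dots> = cmod s ^ m / (1 + e) ^ m * cmod p"
    by (simp only: norm_mult norm_power cmod_w power_divide)
  also have "\<dots> \<le> cmod s ^ m / (1 + e) ^ m * (1 / e)"
    using p_le e by (intro mult_left_mono) auto
  also have "\<dots> = cmod s ^ m / (e * (1 + e) ^ m)"
    by (simp add: mult.commute)
  also have "\<dots> \<le> cmod s ^ m / 1"
    using em e by (intro divide_left_mono) auto
  also have "\<dots> = cmod s ^ m" by simp
  also have "\<dots> \<le> cmod s ^ 2" by (rule power_decreasing) (use m s1 in auto)
  finally have "Re (w ^ m * p) \<le> Re s" using s by linarith
  moreover have "Re p = (\<Sum>j=1..m. Re (s ^ j) / (1 + e) ^ j) + Re (w ^ m * p)"
    by (subst expand[of m]) (simp add: Re_w)
  ultimately show ?thesis by (simp add: p_def)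
qed

section \<open>Power sums over poles in a lower half-plane\<close>

text \<open>Poles are indexed by \<open>I\<close> rather than collected in a set, since reflection
  may map two distinct poles to the same point and both multiplicities must be kept.\<close>

locale lower_poles =
  fixes I :: "'a set" and \<nu> :: "'a \<Rightarrow> nat" and \<zeta> :: "'a \<Rightarrow> complex" and y :: real
  assumes fin: "finite I" and y_pos: "0 < y" and low: "k \<in> I \<Longrightarrow> Im (\<zeta> k) \<le> - y"
begin

text \<open>\<open>g 1\<close> is the simple partial fraction and \<open>g 2\<close> is minus its
  derivative; each \<open>g j\<close> with \<open>j \<ge> 2\<close> is, up to a real factor, a
  Taylor coefficient of that derivative.\<close>

definition g :: "nat \<Rightarrow> complex \<Rightarrow> complex" where
  "g j z = (\<Sum>k\<in>I. of_nat (\<nu> k) / (z - \<zeta> k) ^ j)"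

definition N :: real where
  "N = (\<Sum>k\<in>I. real (\<nu> k))"

lemma N_nonneg: "0 \<le> N"
  by (simp add: N_def sum_nonneg)

lemma pole_neq: "k \<in> I \<Longrightarrow> - y < Im z \<Longrightarrow> z - \<zeta> k \<noteq> 0"
  using low[of k] by auto

lemma has_field_derivative_g:
  assumes "- y < Im z"
  shows "(g j has_field_derivative - of_nat j * g (Suc j) z) (at z)"
proof -
  have D: "((\<lambda>w. c / w ^ j) has_field_derivative - of_nat j * (c / w ^ Suc j)) (at w)"
    if "w \<noteq> 0" for c w :: complex
  proof (cases j)
    case (Suc n)
    have "((\<lambda>w. c / w ^ j) has_field_derivative
        (0 * w ^ j - c * (of_nat j * w ^ (j - Suc 0) * 1)) / (w ^ j * w ^ j)) (at w)"
      using that by (intro DERIV_divide DERIV_const) (auto intro!: derivative_eq_intros)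
    then show ?thesis
      by (rule DERIV_cong) (use that Suc in \<open>simp add: field_simps\<close>)
  qed simp
  have "((\<lambda>z. of_nat (\<nu> k) / (z - \<zeta> k) ^ j) has_field_derivative
          - of_nat j * (of_nat (\<nu> k) / (z - \<zeta> k) ^ Suc j)) (at z)" if "k \<in> I" for k
    using DERIV_chain2[OF D[OF pole_neq[OF that assms]] DERIV_diff[OF DERIV_ident DERIV_const]]
    by simp
  then show ?thesis
    unfolding g_def[abs_def] sum_distrib_left by (intro DERIV_sum)
qed

lemma open_strip: "open {z. - y < Im z}"
  by (simp add: open_halfspace_Im_gt)

lemma holomorphic_g: "A \<subseteq> {z. - y < Im z} \<Longrightarrow> g j holomorphic_on A"
  unfolding holomorphic_on_def field_differentiable_def
  by (blast intro: has_field_derivative_at_within has_field_derivative_g)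

lemma higher_deriv_g:
  assumes "- y < Im z"
  shows "(deriv ^^ i) (g p) z = (- 1) ^ i * pochhammer (of_nat p) i * g (p + i) z"
  using assms
proof (induction i arbitrary: z)
  case (Suc i)
  let ?c = "(- 1) ^ i * pochhammer (of_nat p) i :: complex"
  have "deriv ((deriv ^^ i) (g p)) z = deriv (\<lambda>z. ?c * g (p + i) z) z"
    using Suc.prems Suc.IH
    by (intro complex_derivative_transform_within_open[OF _ _ open_strip])
       (auto intro!: holomorphic_higher_deriv holomorphic_intros holomorphic_g open_strip)
  also have "\<dots> = ?c * (- of_nat (p + i) * g (Suc (p + i)) z)"
    by (intro DERIV_imp_deriv DERIV_cmult has_field_derivative_g Suc.prems)
  finally show ?case
    by (simp add: pochhammer_Suc algebra_simps)
qed simp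

lemma norm_g_le:
  assumes r: "0 < r" and z: "\<And>k. k \<in> I \<Longrightarrow> r \<le> cmod (z - \<zeta> k)"
  shows "cmod (g j z) \<le> N / r ^ j"
proof -
  have "cmod (g j z) \<le> (\<Sum>k\<in>I. cmod (of_nat (\<nu> k) / (z - \<zeta> k) ^ j))"
    unfolding g_def by (rule norm_sum)
  also have "\<dots> \<le> (\<Sum>k\<in>I. real (\<nu> k) / r ^ j)"
  proof (rule sum_mono)
    fix k assume k: "k \<in> I"
    then have "r ^ j \<le> cmod (z - \<zeta> k) ^ j" using r z by (intro power_mono) auto
    moreover have "0 < r ^ j" using r by simp
    ultimately show "cmod (of_nat (\<nu> k) / (z - \<zeta> k) ^ j) \<le> real (\<nu> k) / r ^ j"
      unfolding norm_divide norm_power norm_of_nat by (intro divide_left_mono mult_pos_pos) auto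
  qed
  finally show ?thesis by (simp add: N_def sum_divide_distrib)
qed

end

text \<open>Lets the factorial in Cauchy's inequality be cancelled against the Pochhammer factor
  from repeated differentiation.\<close>

lemma fact_le_pochhammer:
  fixes x :: "'a::linordered_field"
  assumes "1 \<le> x"
  shows "fact i \<le> pochhammer x i"
proof (induction i)
  case (Suc i)
  have "fact (Suc i) = fact i * (1 + of_nat i :: 'a)" by (simp add: algebra_simps)
  also have "\<dots> \<le> pochhammer x i * (x + of_nat i)"
    using Suc assms by (intro mult_mono) (auto intro: order_trans[OF _ Suc])
  finally show ?case by (simp add: pochhammer_Suc)
qed simp

section \<open>Estimates in the upper half-plane\<close>

text \<open>Only the real part is bounded, because reflecting some of the poles preserves nothing
  more on the real line.\<close>

locale lower_poles_bounded = lower_poles +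
  assumes bnd: "\<bar>Re (g 2 (of_real x))\<bar> \<le> 1"
begin

lemma Re_g2_bounded:
  assumes z: "0 \<le> Im z"
  shows "\<bar>Re (g 2 z)\<bar> \<le> 1"
proof -
  obtain B where B: "\<And>k. k \<in> I \<Longrightarrow> cmod (\<zeta> k) \<le> B"
    using bounded_iff[of "\<zeta> ` I"] fin finite_imp_bounded[of "\<zeta> ` I"] by auto
  \<comment> \<open>The half-disc of radius \<open>T\<close> contains \<open>z\<close>, and its arc
    has distance at least \<open>1 + N\<close> from every pole, so that
    \<open>cmod (g 2 w) \<le> N / (1 + N)\<^sup>2 \<le> 1\<close> there.\<close>
  define T where "T = max (cmod z) (B + N + 1)"
  define S where "S = {w. 0 \<le> Im w} \<inter> cball 0 T"
  have S_closed: "closed S"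
    unfolding S_def by (intro closed_Int closed_halfspace_Im_ge closed_cball)
  have S_strip: "S \<subseteq> {w. - y < Im w}" using y_pos by (auto simp: S_def)
  have hol: "g 2 holomorphic_on S" by (rule holomorphic_g[OF S_strip])
  have front: "\<bar>Re (g 2 w)\<bar> \<le> 1" if "w \<in> frontier S" for w
  proof (cases "Im w = 0")
    case True
    then have "w = of_real (Re w)" by (simp add: complex_eq_iff)
    then show ?thesis using bnd by metis
  next
    case False
    have wS: "w \<in> S" using that S_closed frontier_subset_eq by blast
    have "cmod w \<ge> T"
    proof (rule ccontr)
      assume "\<not> cmod w \<ge> T"
      then have "w \<in> {w. 0 < Im w} \<inter> ball 0 T" using wS False by (auto simp: S_def)
      moreover have "open ({w. 0 < Im w} \<inter> ball 0 T)"
        by (intro open_Int open_halfspace_Im_gt open_ball)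
      ultimately have "w \<in> interior S"
        by (intro interiorI[of "{w. 0 < Im w} \<inter> ball 0 T"]) (auto simp: S_def)
      then show False using that by (simp add: frontier_def)
    qed
    then have "1 + N \<le> cmod (w - \<zeta> k)" if "k \<in> I" for k
      using B[OF that] norm_triangle_ineq2[of w "\<zeta> k"] by (simp add: T_def)
    then have "cmod (g 2 w) \<le> N / (1 + N)\<^sup>2"
      using N_nonneg by (intro norm_g_le) auto
    also have "\<dots> \<le> 1"
      using N_nonneg by (simp add: divide_simps power2_eq_square algebra_simps add_nonneg_eq_0_iff)
    finally show ?thesis using abs_Re_le_cmod order_trans by blast
  qed
  have zS: "z \<in> S" using z by (auto simp: S_def T_def)
  have bS: "bounded S" unfolding S_def by (simp add: bounded_Int)
  have cont: "continuous_on (closure S) (g 2)"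
    using hol S_closed by (simp add: holomorphic_on_imp_continuous_on)
  have hol': "g 2 holomorphic_on interior S"
    using hol holomorphic_on_subset interior_subset by blast
  have "Re (g 2 z) \<le> 1"
    using front by (intro maximum_real_frontier[OF hol' cont bS _ zS]) (auto simp: abs_le_iff)
  moreover have "Re (- g 2 z) \<le> 1"
    using front by (intro maximum_real_frontier[OF holomorphic_on_minus[OF hol'] continuous_on_minus[OF cont] bS _ zS])
      (auto simp: abs_le_iff)
  ultimately show ?thesis by simp
qed

text \<open>The derivative of \<open>Im (g 1)\<close> in the vertical direction is
  \<open>- Re (g 2)\<close>, so the bound on the real part suffices.\<close>

lemma Im_g1_diff_le:
  assumes "0 \<le> a" "0 \<le> b"
  shows "\<bar>Im (g 1 (Complex x a)) - Im (g 1 (Complex x b))\<bar> \<le> \<bar>a - b\<bar>"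
proof -
  have D: "((\<lambda>t. Im (g 1 (Complex x t))) has_field_derivative - Re (g 2 (Complex x t)))
      (at t within {0..})" if "t \<in> {0..}" for t
  proof -
    have c: "((\<lambda>t. Complex x t) has_vector_derivative \<i>) (at t within {0..})"
      unfolding Complex_eq by (auto intro!: derivative_eq_intros)
    have "(g 1 has_field_derivative - g 2 (Complex x t)) (at (Complex x t))"
      using has_field_derivative_g[of "Complex x t" 1] that y_pos by (simp add: numeral_2_eq_2)
    from field_vector_diff_chain_within[OF c DERIV_subset[OF this subset_UNIV]]
    have "((\<lambda>t. g 1 (Complex x t)) has_vector_derivative \<i> * - g 2 (Complex x t)) (at t within {0..})"
      by (simp add: o_def)
    from bounded_linear.has_vector_derivative[OF bounded_linear_Im this] show ?thesis
      by (simp add: has_real_derivative_iff_has_vector_derivative)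
  qed
  have "norm (Im (g 1 (Complex x a)) - Im (g 1 (Complex x b))) \<le> 1 * norm (a - b)"
    by (rule field_differentiable_bound[OF _ D]) (use assms Re_g2_bounded in auto)
  then show ?thesis by simp
qed

text \<open>At height \<open>sqrt N\<close> all poles are at distance at least
  \<open>sqrt N\<close>, hence \<open>cmod (g 1) \<le> sqrt N\<close> there. The range of
  \<open>h\<close> keeps the vertical distance to that height at most \<open>sqrt N\<close>.\<close>

lemma minus_Im_g1_le:
  assumes h: "0 \<le> h" "h \<le> 2 * sqrt N" and N: "0 < N"
  shows "- Im (g 1 (Complex x h)) \<le> 2 * sqrt N"
proof -
  let ?W = "sqrt N"
  have "?W \<le> cmod (Complex x ?W - \<zeta> k)" if "k \<in> I" for k
    using low[OF that] y_pos abs_Im_le_cmod[of "Complex x ?W - \<zeta> k"] by simp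
  then have "cmod (g 1 (Complex x ?W)) \<le> N / ?W ^ 1"
    using N by (intro norm_g_le) auto
  also have "\<dots> = ?W" using N by (simp add: real_div_sqrt)
  finally have "\<bar>Im (g 1 (Complex x ?W))\<bar> \<le> ?W"
    using abs_Im_le_cmod order_trans by blast
  moreover have "\<bar>Im (g 1 (Complex x h)) - Im (g 1 (Complex x ?W))\<bar> \<le> \<bar>h - ?W\<bar>"
    using h N by (intro Im_g1_diff_le) auto
  ultimately show ?thesis using h by linarith
qed

text \<open>Exponentiating turns the bound on the real part of \<^term>\<open>g 2\<close> into a bound on a
  holomorphic function, to which Cauchy's inequality applies.\<close>

lemma norm_g3_le:
  assumes r: "0 < r" "r \<le> Im z"
  shows "cmod (g 3 z) \<le> 4 / r"
proof -
  define E where "E = (\<lambda>w. exp (g 2 w))"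
  have ge: "0 \<le> Im w" if "w \<in> cball z r" for w
    using that abs_Im_le_cmod[of "z - w"] r by (auto simp: dist_norm abs_le_iff)
  have sub: "cball z r \<subseteq> {w. - y < Im w}" using ge y_pos by force
  have hol: "E holomorphic_on cball z r"
    unfolding E_def by (intro holomorphic_on_exp' holomorphic_g sub)
  have "cmod ((deriv ^^ 1) E z) \<le> fact 1 * exp 1 / r ^ 1"
  proof (rule Cauchy_inequality)
    fix w assume "cmod (z - w) = r"
    then have "0 \<le> Im w" by (intro ge) (simp add: dist_norm)
    then show "cmod (E w) \<le> exp 1" using Re_g2_bounded by (auto simp: E_def abs_le_iff)
  qed (use hol r in \<open>auto intro: holomorphic_on_imp_continuous_on holomorphic_on_subset\<close>)
  moreover have "(E has_field_derivative E z * (- 2 * g 3 z)) (at z)"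
  proof -
    have "(g 2 has_field_derivative - 2 * g 3 z) (at z)"
      using has_field_derivative_g[of z 2] r y_pos by (simp add: numeral_3_eq_3)
    then show ?thesis unfolding E_def by (rule DERIV_fun_exp)
  qed
  then have "deriv E z = E z * (- 2 * g 3 z)" by (rule DERIV_imp_deriv)
  ultimately have "cmod (E z) * (2 * cmod (g 3 z)) \<le> exp 1 / r"
    by (simp add: norm_mult)
  \<comment> \<open>Removing \<open>E z\<close> costs a second factor e, leaving the constant e^2 /
    2, which is below 2.8^2 / 2 < 4.\<close>
  moreover have "exp (- 1) \<le> cmod (E z)"
    using Re_g2_bounded[of z] r by (simp add: E_def abs_le_iff)
  ultimately have "exp (- 1) * (2 * cmod (g 3 z)) \<le> exp 1 / r"
    by (meson mult_right_mono norm_ge_zero order_trans mult_nonneg_nonneg zero_le_numeral)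
  then have "exp 1 * (exp (- 1) * (2 * cmod (g 3 z))) \<le> exp 1 * (exp 1 / r)"
    by (rule mult_left_mono) simp
  then have "2 * cmod (g 3 z) \<le> exp 1 * exp 1 / r"
    by (simp flip: mult.assoc exp_add)
  also have "\<dots> \<le> 2.8 * 2.8 / r"
    using r e_less_272 by (intro divide_right_mono mult_mono) auto
  finally show ?thesis using r by (simp add: field_simps)
qed

text \<open>Cauchy's inequality for \<open>g 3\<close> on the disc of radius \<open>r\<close>: its
  points have height at least \<open>r\<close>, so \<open>norm_g3_le\<close> bounds
  \<open>g 3\<close> by \<open>4 / r\<close> on it.\<close>

lemma norm_g_ge3_le:
  assumes r: "0 < r" "2 * r \<le> Im z"
  shows "cmod (g (3 + i) z) \<le> 4 / r ^ Suc i"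
proof -
  have ge: "r \<le> Im w" if "w \<in> cball z r" for w
    using that abs_Im_le_cmod[of "z - w"] r by (auto simp: dist_norm abs_le_iff)
  have sub: "cball z r \<subseteq> {w. - y < Im w}" using ge y_pos r by force
  have hol: "g 3 holomorphic_on cball z r" by (intro holomorphic_g sub)
  have "cmod ((deriv ^^ i) (g 3) z) \<le> fact i * (4 / r) / r ^ i"
  proof (rule Cauchy_inequality)
    fix w assume "cmod (z - w) = r"
    then have "r \<le> Im w" by (intro ge) (simp add: dist_norm)
    then show "cmod (g 3 w) \<le> 4 / r" using r by (intro norm_g3_le)
  qed (use hol r in \<open>auto intro: holomorphic_on_imp_continuous_on holomorphic_on_subset\<close>)
  moreover have "(deriv ^^ i) (g 3) z = (- 1) ^ i * pochhammer (of_nat 3) i * g (3 + i) z"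
    using r y_pos by (intro higher_deriv_g) auto
  moreover have "cmod (pochhammer (of_nat 3) i) = pochhammer 3 i"
    by (metis norm_of_nat pochhammer_of_nat of_nat_numeral)
  ultimately have "pochhammer 3 i * cmod (g (3 + i) z) \<le> fact i * (4 / r ^ Suc i)"
    by (simp add: norm_mult norm_power)
  moreover have "fact i * cmod (g (3 + i) z) \<le> pochhammer 3 i * cmod (g (3 + i) z)"
    by (intro mult_right_mono fact_le_pochhammer) auto
  ultimately have "fact i * cmod (g (3 + i) z) \<le> fact i * (4 / r ^ Suc i)" by linarith
  then show ?thesis by (rule mult_left_le_imp_le) simp
qed

section \<open>Summation of the kernel over the poles\<close>

lemma sqrt_order_le:
  assumes k: "k \<in> I" "Im (\<zeta> k) = - y" "1 \<le> \<nu> k" and yN: "y \<le> sqrt N" and m: "2 \<le> m"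
  shows "sqrt (real m) \<le> 12 * y * sqrt N + 6 * 3 ^ m * y\<^sup>2"
proof -
  \<comment> \<open>The point \<open>z\<close> lies at distance \<open>3 * y\<close> straight above
    the pole \<open>\<zeta> k\<close>, so that \<open>s k = 1\<close>, the boundary point where the
    kernel is largest.\<close>
  define z where "z = Complex (Re (\<zeta> k)) (2 * y)"
  define c where "c = \<i> * of_real (3 * y)"
  define s where "s l = c / (z - \<zeta> l)" for l
  define M where "M j = (\<Sum>l\<in>I. real (\<nu> l) * Re (s l ^ j))" for j
  \<comment> \<open>With this choice \<open>m * e\<^sup>2 = 1\<close>, and Bernoulli's inequality
    yields the condition \<open>em\<close> of the kernel expansion.\<close>
  define e where "e = 1 / sqrt (real m)"
  have e: "0 < e" using m by (simp add: e_def)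
  have "1 + real m * e \<le> (1 + e) ^ m" using e by (intro Bernoulli_inequality) simp
  then have "e * (1 + real m * e) \<le> e * (1 + e) ^ m" using e by simp
  moreover have "e * (real m * e) = 1" using m by (simp add: e_def)
  ultimately have em: "1 \<le> e * (1 + e) ^ m" using e by (simp add: distrib_left)
  have s_disc: "(cmod (s l))\<^sup>2 \<le> Re (s l)" if "l \<in> I" for l
  proof -
    define a b where "a = Re (z - \<zeta> l)" and "b = Im (z - \<zeta> l)"
    have b: "3 * y \<le> b" using low[OF that] by (simp add: b_def z_def)
    have ab: "0 < a\<^sup>2 + b\<^sup>2" using b y_pos by (intro add_nonneg_pos) auto
    have "(cmod (s l))\<^sup>2 = (3 * y) * (3 * y) / (a\<^sup>2 + b\<^sup>2)"
      unfolding s_def norm_divide power_divide cmod_power2[of "z - \<zeta> l"] a_def[symmetric] b_def[symmetric]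
      by (simp add: c_def norm_mult power2_eq_square)
    also have "\<dots> \<le> 3 * y * b / (a\<^sup>2 + b\<^sup>2)"
      using b y_pos ab by (intro divide_right_mono mult_left_mono) auto
    also have "\<dots> = Re (s l)"
      unfolding s_def Re_divide a_def[symmetric] b_def[symmetric] by (simp add: c_def)
    finally show ?thesis .
  qed
  have z_k: "z - \<zeta> k = c"
    using k by (simp add: z_def c_def complex_eq_iff)
  have s_k: "s k = 1" unfolding s_def z_k using y_pos by (simp add: c_def)
  have M_g: "M j = Re (c ^ j * g j z)" for j
  proof -
    have "c ^ j * g j z = (\<Sum>l\<in>I. of_real (real (\<nu> l)) * s l ^ j)"
      by (simp add: g_def s_def sum_distrib_left power_divide mult.commute)
    then show ?thesis unfolding M_def Re_sum[symmetric]
      by (simp only: Re_sum Re_complex_of_real times_complex.simps Im_complex_of_real) simp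
  qed
  have cmod_c: "cmod c = 3 * y" using y_pos by (simp add: c_def norm_mult)
  have M1: "M 1 \<le> 6 * y * sqrt N"
  proof -
    have "0 < real (\<nu> k)" using k by simp
    also have "\<dots> \<le> N" unfolding N_def using k fin by (intro member_le_sum) auto
    finally have "- Im (g 1 z) \<le> 2 * sqrt N"
      unfolding z_def using yN y_pos by (intro minus_Im_g1_le) auto
    then have "3 * y * (- Im (g 1 z)) \<le> 3 * y * (2 * sqrt N)"
      using y_pos by (intro mult_left_mono) auto
    then show ?thesis by (simp add: M_g c_def)
  qed
  have M_nonneg: "0 \<le> M 1"
    unfolding M_def using s_disc by (intro sum_nonneg mult_nonneg_nonneg) (auto intro: order_trans[OF zero_le_power2])
  \<comment> \<open>For \<open>j = 2\<close> the factor \<open>c\<^sup>2\<close> is real, so the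
    bound on \<open>Re (g 2 z)\<close> is enough. For larger \<open>j\<close>, the height
    \<open>2 * y\<close> of \<open>z\<close> admits \<open>r = y\<close> in
    \<open>norm_g_ge3_le\<close>.\<close>
  have M_le: "M j \<le> 4 * y\<^sup>2 * 3 ^ j" if j: "2 \<le> j" for j
  proof (cases "j = 2")
    case True
    have "c\<^sup>2 = of_real (- 9 * y\<^sup>2)" by (simp add: c_def power2_eq_square)
    then have "M 2 = - 9 * y\<^sup>2 * Re (g 2 z)"
      unfolding M_g by (simp only: times_complex.simps Re_complex_of_real Im_complex_of_real)
    also have "\<dots> \<le> 9 * y\<^sup>2 * 1"
      using Re_g2_bounded[of z] y_pos mult_left_mono[of "- Re (g 2 z)" 1 "9 * y\<^sup>2"]
      by (simp add: z_def abs_le_iff)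
    also have "\<dots> \<le> 4 * y\<^sup>2 * 3 ^ j" using True by simp
    finally show ?thesis using True by simp
  next
    case False
    then obtain i where i: "j = 3 + i" using j nat_le_iff_add[of 3 j] by auto
    have "M j \<le> cmod (c ^ j * g j z)" unfolding M_g by (rule complex_Re_le_cmod)
    also have "\<dots> = (3 * y) ^ j * cmod (g j z)" by (simp add: norm_mult norm_power cmod_c)
    also have "\<dots> \<le> (3 * y) ^ j * (4 / y ^ Suc i)"
      unfolding i using y_pos by (intro mult_left_mono norm_g_ge3_le) (auto simp: z_def)
    also have "\<dots> = 4 * y\<^sup>2 * 3 ^ j"
      using y_pos by (simp add: i power_mult_distrib power_add field_simps eval_nat_numeral)
    finally show ?thesis .
  qed
  have M_div: "M j / (1 + e) ^ j \<le> 4 * y\<^sup>2 * 3 ^ j" if "2 \<le> j" for j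
  proof -
    have "M j / (1 + e) ^ j \<le> 4 * y\<^sup>2 * 3 ^ j / (1 + e) ^ j"
      using M_le[OF that] e by (intro divide_right_mono) auto
    also have "\<dots> \<le> 4 * y\<^sup>2 * 3 ^ j / 1"
      using e y_pos by (intro divide_left_mono) (auto intro: one_le_power)
    finally show ?thesis by simp
  qed
  have geom: "(\<Sum>j=2..m. (3::real) ^ j) \<le> 3 ^ Suc m / 2"
  proof -
    have "(\<Sum>j=2..m. (3::real) ^ j) = - ((9 - 3 * 3 ^ m) / 2)"
      using sum_gp[of "3::real" 2 m] m by simp
    moreover have "- ((9 - 3 * x) / 2) \<le> 3 * x / 2" for x :: real by (simp add: field_simps)
    ultimately show ?thesis by (simp only: power_Suc)
  qed
  have tail: "(\<Sum>j=2..m. 4 * y\<^sup>2 * 3 ^ j) \<le> 4 * y\<^sup>2 * (3 ^ Suc m / 2)"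
    unfolding sum_distrib_left[symmetric] by (intro mult_left_mono geom) simp
  have "sqrt (real m) = Re (s k / (1 + of_real e - s k))"
    using m by (simp add: s_k e_def Re_divide)
  also have "\<dots> \<le> real (\<nu> k) * Re (s k / (1 + of_real e - s k))"
    using k Re_Cauchy_kernel_nonneg[OF s_disc[OF k(1)] e] by (simp add: mult_le_cancel_right1)
  also have "\<dots> \<le> (\<Sum>l\<in>I. real (\<nu> l) * Re (s l / (1 + of_real e - s l)))"
    using k fin Re_Cauchy_kernel_nonneg[OF s_disc e]
    by (intro member_le_sum mult_nonneg_nonneg) auto
  also have "\<dots> \<le> (\<Sum>l\<in>I. real (\<nu> l) * (Re (s l) + (\<Sum>j=1..m. Re (s l ^ j) / (1 + e) ^ j)))"
    using Re_Cauchy_kernel_le[OF s_disc e m em] by (intro sum_mono mult_left_mono) auto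
  also have "\<dots> = M 1 + (\<Sum>j=1..m. M j / (1 + e) ^ j)"
    by (simp add: M_def distrib_left sum.distrib sum_distrib_left sum_divide_distrib)
       (rule sum.swap)
  also have "(\<Sum>j=1..m. M j / (1 + e) ^ j) = M 1 / (1 + e) + (\<Sum>j=2..m. M j / (1 + e) ^ j)"
    using m by (simp add: sum.atLeast_Suc_atMost numeral_2_eq_2)
  \<comment> \<open>\<open>M 1\<close> occurs twice, from the remainder and from the linear term;
    this doubles the constant 6 of \<open>M1\<close> to 12.\<close>
  also have "M 1 + \<dots> \<le> M 1 + (M 1 + (\<Sum>j=2..m. 4 * y\<^sup>2 * 3 ^ j))"
    using M_nonneg e M_div
    by (intro add_mono sum_mono order.refl) (auto simp: divide_le_eq mult_le_cancel_left1)
  also have "\<dots> \<le> 12 * y * sqrt N + 4 * y\<^sup>2 * (3 ^ Suc m / 2)"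
    using M1 tail by linarith
  finally show ?thesis by (simp add: mult.commute)
qed

end

section \<open>From the essential bound to pointwise bounds, and absence of real poles\<close>

text \<open>By continuity the inequality would fail on a nonempty open set, which cannot be
  null.\<close>

lemma AE_lborel_le_imp_le:
  fixes h b :: "real \<Rightarrow> real"
  assumes ae: "AE x in lborel. x \<in> A \<longrightarrow> h x \<le> b x" and A: "open A"
    and cont: "continuous_on A h" "continuous_on A b" and x: "x \<in> A"
  shows "h x \<le> b x"
proof (rule ccontr)
  assume "\<not> h x \<le> b x"
  define U where "U = A \<inter> (\<lambda>x. h x - b x) -` {0<..}"
  have "open U"
    unfolding U_def using cont A by (intro continuous_open_preimage continuous_intros) auto
  moreover have "AE x\<in>U in lebesgue. x \<in> {}"
    using ae by (intro AE_completion) (auto simp: U_def elim!: eventually_mono)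
  moreover have "x \<in> U" using x \<open>\<not> h x \<le> b x\<close> by (simp add: U_def)
  ultimately show False using mem_closed_if_AE_lebesgue_open[of U "{}" x] by auto
qed

lemma deriv_spf:
  assumes "finite S" "z \<notin> S"
  shows "deriv (spf S \<nu>) z = - (\<Sum>\<xi>\<in>S. of_nat (\<nu> \<xi>) / (z - \<xi>)\<^sup>2)"
proof -
  have "((\<lambda>z. of_nat (\<nu> \<xi>) / (z - \<xi>)) has_field_derivative - (of_nat (\<nu> \<xi>) / (z - \<xi>)\<^sup>2)) (at z)"
    if "\<xi> \<in> S" for \<xi>
    using that assms by (auto intro!: derivative_eq_intros simp: power2_eq_square)
  then have "(spf S \<nu> has_field_derivative (\<Sum>\<xi>\<in>S. - (of_nat (\<nu> \<xi>) / (z - \<xi>)\<^sup>2))) (at z)"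
    unfolding spf_def[abs_def] by (intro DERIV_sum)
  then show ?thesis by (simp add: DERIV_imp_deriv sum_negf)
qed

lemma open_of_real_notin:
  assumes "finite S"
  shows "open {x::real. of_real x \<notin> (S :: complex set)}"
proof -
  have "closed ((of_real :: real \<Rightarrow> complex) -` S)"
    using assms by (intro closed_vimage finite_imp_closed continuous_intros)
  moreover have "{x::real. of_real x \<notin> S} = - (of_real -` S)" by auto
  ultimately show ?thesis by (simp add: open_Compl)
qed

lemma AE_norm_deriv_spf_le:
  assumes "Linf_norm_real_line (deriv (spf S \<nu>)) \<le> 1"
  shows "AE x in lborel. cmod (deriv (spf S \<nu>) (of_real x)) \<le> 1"
proof -
  have "AE x in lborel. ereal (cmod (deriv (spf S \<nu>) (of_real x)))
      \<le> Linf_norm_real_line (deriv (spf S \<nu>))"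
    unfolding Linf_norm_real_line_def by (rule esssup_AE)
  then show ?thesis
  proof (eventually_elim)
    case (elim x)
    then have "ereal (cmod (deriv (spf S \<nu>) (of_real x))) \<le> 1" using assms by (rule order_trans)
    then show ?case by (simp add: one_ereal_def)
  qed
qed

text \<open>Multiplying the bound on the derivative by \<open>(x - r)\<^sup>2\<close> isolates the
  double pole at \<open>r\<close> and leaves a continuous inequality valid almost everywhere near
  \<open>r\<close>. Its extension to \<open>x = r\<close> reads \<open>1 \<le> 0\<close>.\<close>

lemma no_real_pole:
  assumes pd: "pole_data n S \<nu>" and bd: "Linf_norm_real_line (deriv (spf S \<nu>)) \<le> 1"
  shows "of_real r \<notin> S"
proof
  assume r: "of_real r \<in> S"
  have fin: "finite S" and nu: "1 \<le> \<nu> (of_real r)" using pd r by (auto simp: pole_data_def)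
  define T where "T = S - {of_real r}"
  define R where "R x = (\<Sum>\<xi>\<in>T. of_nat (\<nu> \<xi>) / (of_real x - \<xi>)\<^sup>2)" for x :: real
  define A where "A = {x::real. of_real x \<notin> T}"
  have "AE x in lborel. x \<in> A \<longrightarrow> 1 \<le> (x - r)\<^sup>2 * (1 + cmod (R x))"
    using AE_norm_deriv_spf_le[OF bd] AE_lborel_singleton[of r]
  proof eventually_elim
    case (elim x)
    show ?case
    proof
      assume "x \<in> A"
      then have "of_real x \<notin> S" using elim by (auto simp: A_def T_def)
      then have "deriv (spf S \<nu>) (of_real x) = - (of_nat (\<nu> (of_real r)) / (of_real x - of_real r)\<^sup>2 + R x)"
        using r fin by (simp add: deriv_spf R_def T_def sum.remove[of S "of_real r"])
      then have "cmod (of_nat (\<nu> (of_real r)) / (of_real x - of_real r)\<^sup>2 + R x) \<le> 1"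
        using elim by (simp only: norm_minus_cancel)
      then have "cmod (of_nat (\<nu> (of_real r)) / (of_real x - of_real r)\<^sup>2) \<le> 1 + cmod (R x)"
        using norm_triangle_ineq4[of "of_nat (\<nu> (of_real r)) / (of_real x - of_real r)\<^sup>2 + R x" "R x"] by simp
      moreover have "cmod (of_nat (\<nu> (of_real r)) / (of_real x - of_real r)\<^sup>2) = real (\<nu> (of_real r)) / (x - r)\<^sup>2"
        by (simp add: norm_divide norm_power flip: of_real_diff)
      ultimately have "real (\<nu> (of_real r)) \<le> (x - r)\<^sup>2 * (1 + cmod (R x))"
        using elim by (simp add: divide_le_eq mult.commute)
      then show "1 \<le> (x - r)\<^sup>2 * (1 + cmod (R x))" using nu by linarith
    qed
  qed
  moreover have "open A" unfolding A_def using fin by (intro open_of_real_notin) (simp add: T_def)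
  moreover have "continuous_on A R"
    unfolding R_def A_def by (intro continuous_intros) auto
  then have "continuous_on A (\<lambda>x. (x - r)\<^sup>2 * (1 + cmod (R x)))" by (intro continuous_intros)
  moreover have "r \<in> A" by (simp add: A_def T_def)
  ultimately have "1 \<le> (r - r)\<^sup>2 * (1 + cmod (R r))"
    by (intro AE_lborel_le_imp_le[of A "\<lambda>_. 1"]) auto
  then show False by simp
qed

lemma norm_sum_poles_le:
  assumes pd: "pole_data n S \<nu>" and bd: "Linf_norm_real_line (deriv (spf S \<nu>)) \<le> 1"
  shows "cmod (\<Sum>\<xi>\<in>S. of_nat (\<nu> \<xi>) / (of_real x - \<xi>)\<^sup>2) \<le> 1"
proof -
  have fin: "finite S" using pd by (simp add: pole_data_def)
  note nr = no_real_pole[OF pd bd]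
  have "AE x in lborel. x \<in> UNIV \<longrightarrow> cmod (\<Sum>\<xi>\<in>S. of_nat (\<nu> \<xi>) / (of_real x - \<xi>)\<^sup>2) \<le> 1"
    using AE_norm_deriv_spf_le[OF bd] by eventually_elim (simp add: deriv_spf[OF fin nr])
  moreover have "continuous_on UNIV (\<lambda>x. cmod (\<Sum>\<xi>\<in>S. of_nat (\<nu> \<xi>) / (of_real x - \<xi>)\<^sup>2))"
    using nr by (intro continuous_intros) auto
  ultimately show ?thesis by (intro AE_lborel_le_imp_le[of UNIV _ "\<lambda>_. 1"]) auto
qed

section \<open>Reflection of the poles and choice of parameters\<close>

lemma sqrt_le_of_Linf_norm_le:
  assumes pd: "pole_data n S \<nu>" and bd: "Linf_norm_real_line (deriv (spf S \<nu>)) \<le> 1"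
    and n: "0 < n" and yn: "Y S \<le> sqrt n" and m: "2 \<le> m"
  shows "0 < Y S" "sqrt (real m) \<le> 12 * Y S * sqrt n + 6 * 3 ^ m * (Y S)\<^sup>2"
proof -
  have fin: "finite S" using pd by (simp add: pole_data_def)
  have ne: "S \<noteq> {}" using pd n by (auto simp: pole_data_def)
  have "Y S \<in> (\<lambda>\<xi>. \<bar>Im \<xi>\<bar>) ` S" unfolding Y_def using fin ne by (intro Min_in) auto
  then obtain k where k: "k \<in> S" "Y S = \<bar>Im k\<bar>" by blast
  have Y_le: "Y S \<le> \<bar>Im \<xi>\<bar>" if "\<xi> \<in> S" for \<xi> unfolding Y_def using fin that by auto
  have "Im k \<noteq> 0"
    using no_real_pole[OF pd bd, of "Re k"] k by (metis complex_is_Real_iff of_real_Re)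
  then show pos: "0 < Y S" using k by simp
  define \<zeta> where "\<zeta> \<xi> = (if Im \<xi> < 0 then \<xi> else cnj \<xi>)" for \<xi>
  have Im_\<zeta>: "Im (\<zeta> \<xi>) = - \<bar>Im \<xi>\<bar>" for \<xi> by (simp add: \<zeta>_def)
  interpret lower_poles S \<nu> \<zeta> "Y S"
    by unfold_locales (use fin pos Y_le in \<open>auto simp: Im_\<zeta>\<close>)
  \<comment> \<open>At real \<open>x\<close>, reflecting a pole conjugates its term.\<close>
  have Re_g: "Re (g 2 (of_real x)) = Re (\<Sum>\<xi>\<in>S. of_nat (\<nu> \<xi>) / (of_real x - \<xi>)\<^sup>2)" for x
  proof -
    have "Re (of_nat (\<nu> \<xi>) / (of_real x - cnj \<xi>)\<^sup>2) = Re (of_nat (\<nu> \<xi>) / (of_real x - \<xi>)\<^sup>2)" for \<xi>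
    proof -
      have "of_nat (\<nu> \<xi>) / (of_real x - cnj \<xi>)\<^sup>2 = cnj (of_nat (\<nu> \<xi>) / (of_real x - \<xi>)\<^sup>2)" by simp
      then show ?thesis by (simp only: cnj.simps)
    qed
    then show ?thesis unfolding g_def Re_sum by (intro sum.cong) (auto simp: \<zeta>_def)
  qed
  interpret lower_poles_bounded S \<nu> \<zeta> "Y S"
    by unfold_locales (use Re_g norm_sum_poles_le[OF pd bd] abs_Re_le_cmod order_trans in metis)
  have N: "N = real n" using pd by (simp add: N_def pole_data_def flip: of_nat_sum)
  have "1 \<le> \<nu> k" using pd k by (simp add: pole_data_def)
  then show "sqrt (real m) \<le> 12 * Y S * sqrt n + 6 * 3 ^ m * (Y S)\<^sup>2"
    using sqrt_order_le[of k m] k yn m by (simp add: N Im_\<zeta>)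
qed

lemma Y_ge:
  assumes pd: "pole_data n S \<nu>" and bd: "Linf_norm_real_line (deriv (spf S \<nu>)) \<le> 1"
    and n: "8 \<le> ln (real n)"
  shows "1 / 100 * sqrt (ln (real n) / real n) \<le> Y S"
proof (rule ccontr)
  define L where "L = ln (real n)"
  assume "\<not> 1 / 100 * sqrt (ln (real n) / real n) \<le> Y S"
  then have small: "Y S < 1 / 100 * sqrt (L / n)" by (simp add: L_def)
  have L: "8 \<le> L" using n by (simp add: L_def)
  have n0: "0 < n" using n by (cases n) auto
  have L_le: "L \<le> 2 * sqrt n"
    using ln_le_minus_one[of "sqrt n"] n0 by (simp add: L_def ln_sqrt)
  have L_n: "L \<le> n" using ln_le_minus_one[of "real n"] n0 by (simp add: L_def)
  have "sqrt (L / n) \<le> 1" using L_n n0 by simp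
  moreover have "1 \<le> sqrt n" using n0 by simp
  ultimately have Yn: "Y S \<le> sqrt n" using small by linarith
  \<comment> \<open>\<open>m \<le> L / 4\<close> gives
    \<open>3 ^ m \<le> exp (2 * m) \<le> sqrt n\<close>, while \<open>L \<ge> 8\<close> ensures that
    rounding down still leaves \<open>m \<ge> L / 8\<close> and \<open>m \<ge> 2\<close>.\<close>
  define m where "m = nat \<lfloor>L / 4\<rfloor>"
  have m: "2 \<le> m" "L / 8 \<le> m" "m \<le> L / 4" using L unfolding m_def by linarith+
  note main = sqrt_le_of_Linf_norm_le[OF pd bd n0 Yn m(1)]
  have "12 * Y S * sqrt n \<le> 12 * (1 / 100 * sqrt (L / n)) * sqrt n"
    using small by (intro mult_right_mono mult_left_mono) auto
  also have "\<dots> = 12 / 100 * sqrt L" using n0 by (simp add: real_sqrt_divide)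
  finally have 1: "12 * Y S * sqrt n \<le> 12 / 100 * sqrt L" .
  have "(3::real) ^ m \<le> exp 2 ^ m" using exp_ge_add_one_self[of 2] by (intro power_mono) auto
  also have "\<dots> = exp (2 * real m)" by (simp add: exp_of_nat_mult[symmetric] mult.commute)
  also have "\<dots> \<le> exp (ln (sqrt n))" using m n0 by (simp add: L_def ln_sqrt)
  also have "\<dots> = sqrt n" using n0 by simp
  finally have pow: "(3::real) ^ m \<le> sqrt n" .
  have "(Y S)\<^sup>2 \<le> (1 / 100 * sqrt (L / n))\<^sup>2"
    using small main(1) by (intro power_mono) auto
  also have "\<dots> = L / n / 10000" using L by (simp add: power_mult_distrib power_divide)
  also have "\<dots> \<le> 2 * sqrt n / n / 10000" using L_le by (intro divide_right_mono) auto
  finally have "3 ^ m * (Y S)\<^sup>2 \<le> sqrt n * (2 * sqrt n / n / 10000)"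
    using pow by (intro mult_mono) auto
  also have "\<dots> = 2 / 10000" using n0 by simp
  finally have 2: "6 * 3 ^ m * (Y S)\<^sup>2 \<le> 12 / 10000" by simp
  \<comment> \<open>The lower bound \<open>sqrt L / 3\<close> for \<open>sqrt m\<close> has a larger
    coefficient than the 12 / 100 of the upper bound; this forces \<open>sqrt L < 1\<close>,
    contrary to \<open>L \<ge> 8\<close>.\<close>
  have "(1 / 3 * sqrt L)\<^sup>2 \<le> L / 8" using L by (simp add: power_mult_distrib power_divide)
  then have "1 / 3 * sqrt L \<le> sqrt (L / 8)" by (rule real_le_rsqrt)
  also have "\<dots> \<le> sqrt m" using m by simp
  also have "\<dots> \<le> 12 / 100 * sqrt L + 12 / 10000" using main(2) 1 2 by linarith
  finally have "sqrt L < 1" by linarith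
  then show False using L by simp
qed

theorem theorem2:
  shows "\<exists>c::real. c > 0 \<and> (\<exists>n\<^sub>0::nat. n\<^sub>0 > 0 \<and>
           (\<forall>n::nat. n \<ge> n\<^sub>0 \<longrightarrow> d' n \<ge> ereal (c * sqrt (ln (real n) / real n))))"
proof (intro exI[of _ "1 / 100"] conjI exI[of _ "nat \<lceil>exp 8 :: real\<rceil>"] allI impI)
  fix n :: nat assume "nat \<lceil>exp 8 :: real\<rceil> \<le> n"
  \<comment> \<open>The threshold is e^8 rounded up, so that \<open>Y_ge\<close> applies from there
    on.\<close>
  then have le: "exp 8 \<le> real n" by linarith
  then have "0 < real n" using exp_gt_zero[of "8::real"] by linarith
  then have "8 \<le> ln (real n)" using le by (simp add: ln_ge_iff)
  then show "ereal (1 / 100 * sqrt (ln (real n) / real n)) \<le> d' n"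
    unfolding d'_def by (intro Inf_greatest) (use Y_ge in auto)
qed simp_all

end
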